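(* Let $q$ be a prime with $q\equiv 3 \pmod 4$ and let $S=\{2,q\}$. Then there is no $S$-Diophantine quadruple.
   Context: For a finite set $S$ of primes, a positive integer is an $S$-unit if all its prime factors lie in $S$. An $m$-tuple $(a_1,\ldots,a_m)$ of positive, pairwise distinct integers is called an $S$-Diophantine $m$-tuple if $a_ia_j+1$ is an $S$-unit for all $i\neq j$. An $S$-Diophantine quadruple is the case $m=4$. *)

theory Defs
  imports "HOL-Number_Theory.Number_Theory"
begin

definition S_unit :: "nat set \<Rightarrow> nat \<Rightarrow> bool" where
  "S_unit S n \<longleftrightarrow> n > 0 \<and> prime_factors n \<subseteq> S"

definition S_diophantine_tuple :: "nat set \<Rightarrow> nat \<Rightarrow> nat list \<Rightarrow> bool" where
  "S_diophantine_tuple S m xs \<longleftrightarrow>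
     length xs = m \<and> (\<forall>x\<in>set xs. x > 0) \<and> distinct xs \<and>
     (\<forall>i<m. \<forall>j<m. i \<noteq> j \<longrightarrow> S_unit S (xs ! i * xs ! j + 1))"

abbreviation S_diophantine_quadruple :: "nat set \<Rightarrow> nat list \<Rightarrow> bool" where
  "S_diophantine_quadruple S \<equiv> S_diophantine_tuple S 4"

end

theory Submission
  imports Defs
begin

text \<open>
  Since \<open>- 1\<close> is a square neither modulo \<open>4\<close> nor modulo \<open>q\<close>, the three values \<open>rs + 1\<close>, \<open>rt + 1\<close>,
  \<open>st + 1\<close> of a triple are never all divisible by \<open>4\<close>, nor all divisible by \<open>q\<close>. Hence all members
  of a quadruple are odd, and viewing pairs as edges of \<open>K\<^sub>4\<close>, the edges not divisible by \<open>4\<close> and those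
  not divisible by \<open>q\<close> each contain a perfect matching. So the quadruple can be named such that
  \<open>xy + 1 = 2q\<^sup>e\<close>, \<open>zw + 1 = 2q\<^sup>f\<close>, \<open>xz + 1 = 2\<^sup>g\<close>, \<open>yw + 1 = 2\<^sup>h\<close>, \<open>xw + 1 = 2\<^sup>i q\<^sup>j\<close>,
  \<open>yz + 1 = 2\<^sup>k q\<^sup>l\<close> with \<open>x\<close> maximal.

  If \<open>xy + 1\<close> divides \<open>xw + 1\<close> and \<open>w \<noteq> y\<close>, then \<open>w > xy\<close>. By maximality of \<open>x\<close> this gives \<open>e > j\<close> and
  \<open>g > i\<close>, so \<open>2q\<^sup>j\<close> divides \<open>y - w\<close> and \<open>2\<^sup>i\<close> divides \<open>z - w\<close>. The product of these differences is
  therefore at least \<open>2(xw + 1)\<close>, which forces \<open>w < y\<close>, \<open>w < z\<close> and \<open>xw < yz\<close>. Comparing the valuations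
  of \<open>xyzw - 1\<close> at \<open>q\<close> and \<open>2\<close>, \<open>j \<noteq> l\<close> implies \<open>f \<le> l\<close>, hence \<open>y > zw\<close>, while \<open>i \<noteq> k\<close> implies
  \<open>h \<le> k\<close>, hence \<open>z > yw\<close>. So exactly one of \<open>j = l\<close>, \<open>i = k\<close> holds, and a size estimate
  excludes both cases.
\<close>

section \<open>Size and valuation estimates from divisibility\<close>

text \<open>The divisor is coprime to \<open>x\<close> and divides the difference
  \<open>x * (w - y)\<close>, hence \<open>w - y\<close>; as \<open>y \<le> x * y\<close>, it is too
  large for \<open>w < y\<close>.\<close>

lemma product_plus_one_dvd_imp_gt:
  fixes x y w :: int
  assumes "x > 0" "y > 0" "w > 0" "w \<noteq> y" and dvd: "x * y + 1 dvd x * w + 1"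
  shows "w > x * y"
proof -
  have "x * y + 1 dvd (x * w + 1) - (x * y + 1)"
    using dvd by (rule dvd_diff) simp
  then have "x * y + 1 dvd x * (w - y)"
    by (simp add: algebra_simps)
  moreover have "coprime (x * y + 1) x"
    by (metis coprime_1_left gcd_add_mult coprime_iff_gcd_eq_1 gcd.commute mult.commute)
  ultimately have "x * y + 1 dvd w - y"
    using coprime_dvd_mult_right_iff by blast
  then have le: "x * y + 1 \<le> \<bar>w - y\<bar>"
    using \<open>w \<noteq> y\<close> by (metis dvd_abs_iff zdvd_imp_le right_minus_eq zero_less_abs_iff)
  have "y \<le> x * y"
    using assms by (simp add: mult_le_cancel_right1)
  then show ?thesis
    using le assms(2,3) by linarith
qed

text \<open>In the application both sides of \<open>eq\<close> are \<open>xyzw - 1\<close>, expanded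
  from two pairings of the factors. If \<open>a'\<close> and \<open>b'\<close> both exceeded
  \<open>b\<close>, every term except \<open>p ^ b * v\<close> would be divisible by
  \<open>p ^ Suc b\<close>.\<close>

lemma prime_power_min_le:
  fixes p :: int
  assumes "prime p" "\<not> p dvd v" "a' < a"
    and eq: "p ^ (a + b) * c - p ^ a * u - p ^ b * v
           = p ^ (a' + b') * c' - p ^ a' * u' - p ^ b' * v'"
  shows "min a' b' \<le> b"
proof (rule ccontr)
  assume "\<not> min a' b' \<le> b"
  then have b: "Suc b \<le> a'" "Suc b \<le> b'" "Suc b \<le> a"
    using assms(3) by auto
  have "p ^ Suc b dvd p ^ (a + b) * c - p ^ a * u - (p ^ (a' + b') * c' - p ^ a' * u' - p ^ b' * v')"
    using b by (intro dvd_diff dvd_mult2 le_imp_power_dvd) auto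
  also have "\<dots> = p ^ b * v"
    using eq by simp
  finally show False
    using assms(1,2) by (auto simp: mult.commute[of p])
qed

text \<open>As \<open>a' \<noteq> b'\<close>, the sum \<open>p ^ a' * u' + p ^ b' * v'\<close> has
  valuation exactly \<open>min a' b'\<close>; for larger \<open>b\<close> all other terms would be
  divisible by a higher power of \<open>p\<close>.\<close>

lemma prime_power_le_min:
  fixes p :: int
  assumes "prime p" "\<not> p dvd u'" "\<not> p dvd v'" "a' < a" "a' \<noteq> b'"
    and eq: "p ^ (a + b) * c - p ^ a * u - p ^ b * v
           = p ^ (a' + b') * c' - p ^ a' * u' - p ^ b' * v'"
  shows "b \<le> min a' b'"
proof (rule ccontr)
  assume neg: "\<not> b \<le> min a' b'"
  define m where "m = min a' b'"
  have b: "Suc m \<le> a" "Suc m \<le> b" "Suc m \<le> a' + b'"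
    using neg assms(4,5) by (auto simp: m_def min_def split: if_splits)
  have "p ^ Suc m dvd p ^ (a' + b') * c' - (p ^ (a + b) * c - p ^ a * u - p ^ b * v)"
    using b by (intro dvd_diff dvd_mult2 le_imp_power_dvd) auto
  also have "\<dots> = p ^ a' * u' + p ^ b' * v'"
    using eq by simp
  finally have *: "p ^ Suc m dvd p ^ a' * u' + p ^ b' * v'" .
  show False
  proof (cases "a' < b'")
    case True
    then have "m = a'" "p ^ Suc m dvd p ^ b' * v'"
      by (auto simp: m_def simp del: power_Suc intro!: dvd_mult2 le_imp_power_dvd)
    then have "p ^ Suc a' dvd p ^ a' * u'"
      using * dvd_add_left_iff by blast
    then show False
      using assms(1,2) by (auto simp: mult.commute[of p])
  next
    case False
    then have "m = b'" "p ^ Suc m dvd p ^ a' * u'"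
      using assms(5) by (auto simp: m_def simp del: power_Suc intro!: dvd_mult2 le_imp_power_dvd)
    then have "p ^ Suc b' dvd p ^ b' * v'"
      using * dvd_add_right_iff by blast
    then show False
      using assms(1,3) by (auto simp: mult.commute[of p])
  qed
qed

text \<open>
  The two remaining cases \<open>i = k, j < l\<close> and \<open>j = l, i < k\<close> coincide up to exchanging \<open>y\<close> with \<open>z\<close>
  and the powers of \<open>2\<close> with those of \<open>q\<close>. Here \<open>v = y - PDw\<close> is positive with \<open>P dvd vw + 1\<close>,
  yet too small for that.
\<close>

lemma no_final_configuration:
  fixes w x y z P Q D :: int
  assumes pos: "w > 0" "z > 0" "P > 0" "Q > 0" "D > 0"
    and zw: "z * w + 1 = 2 * Q" and xw: "x * w + 1 = 2 * P * Q"
    and yz: "y * z + 1 = 2 * P * Q * D"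
    and "P dvd y * w + 1" "2 * P \<le> z - w" "Q * D dvd x - z" "z < x"
  shows False
proof -
  obtain U where U: "x - z = Q * D * U"
    using \<open>Q * D dvd x - z\<close> by (elim dvdE)
  have "0 < Q * D * U" "0 < Q * D"
    using U \<open>z < x\<close> pos by auto
  then have "U > 0"
    using zero_less_mult_pos by blast
  have "w * (x - z) = 2 * Q * (P - 1)"
    using zw xw by (simp add: algebra_simps)
  then have "Q * (w * D * U) = Q * (2 * (P - 1))"
    by (simp add: U algebra_simps)
  then have wDU: "w * D * U = 2 * (P - 1)"
    using pos by simp
  have "w * D \<le> w * D * U"
    using mult_left_mono[of 1 U "w * D"] \<open>U > 0\<close> pos by simp
  then have wD: "w * D \<le> 2 * (P - 1)"
    using wDU by simp
  \<comment> \<open>Since \<open>y * z + 1\<close> is \<open>P * D\<close> times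
    \<open>z * w + 1\<close>, removing \<open>P * D * w\<close> from \<open>y\<close> leaves
    \<open>z * v = P * D - 1\<close>.\<close>
  define v where "v = y - P * D * w"
  have "P * D * (z * w + 1) = y * z + 1"
    by (simp add: zw yz)
  then have zv: "z * v = P * D - 1"
    by (simp add: v_def algebra_simps)
  have "0 < w * D"
    using pos by simp
  then have "P \<ge> 2"
    using wD by simp
  moreover have "P * 1 \<le> P * D"
    using pos by (intro mult_left_mono) auto
  ultimately have "0 < z * v"
    using zv by linarith
  then have "v > 0"
    using pos zero_less_mult_pos by blast
  \<comment> \<open>From \<open>2 * P \<le> z\<close> follows \<open>2 * v < D\<close>; together
    with the bound on \<open>w * D\<close> this puts \<open>v * w + 1\<close> below
    \<open>P\<close>.\<close>
  have "P * (2 * v) \<le> z * v"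
    using mult_right_mono[of "2 * P" z v] \<open>v > 0\<close> \<open>2 * P \<le> z - w\<close> pos by (simp add: algebra_simps)
  then have "P * (2 * v) < P * D"
    using zv by linarith
  then have "2 * v < D"
    using pos by simp
  then have "w * (2 * v) < w * D"
    using pos by simp
  then have small: "v * w + 1 < P"
    using wD by (simp add: algebra_simps)
  have "y * w + 1 = P * (D * w * w) + (v * w + 1)"
    by (simp add: v_def algebra_simps)
  then have "P dvd v * w + 1"
    using \<open>P dvd y * w + 1\<close> by (metis dvd_add_right_iff dvd_triv_left)
  moreover have "0 < v * w + 1"
    using \<open>v > 0\<close> pos by (simp add: add_pos_pos)
  ultimately show False
    using small zdvd_imp_le by fastforce
qed

section \<open>Quadruples with prescribed factorization pattern\<close>

lemma no_quadruple_of_shape_max: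
  fixes q w x y z :: int
  assumes q: "prime q" "odd q"
    and pos: "x > 0" "y > 0" "z > 0" "w > 0" and odd: "odd x" "odd y" "odd z" "odd w"
    and max: "y < x" "z < x" "w < x" and ne: "y \<noteq> z" "y \<noteq> w" "z \<noteq> w"
    and xy: "x * y + 1 = 2 * q ^ e" and zw: "z * w + 1 = 2 * q ^ f"
    and xz: "x * z + 1 = 2 ^ g" and yw: "y * w + 1 = 2 ^ h"
    and xw: "x * w + 1 = 2 ^ i * q ^ j" and yz: "y * z + 1 = 2 ^ k * q ^ l"
  shows False
proof -
  have q1: "q > 1"
    using q by (simp add: prime_gt_1_int)
  have nq2: "\<not> q dvd 2 ^ n" for n
    using q by (metis prime_dvd_power primes_dvd_imp_eq prime_int_numeral_eq two_is_prime_nat even_numeral)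
  have n2q: "\<not> 2 dvd q ^ n" for n
    using q by simp
  \<comment> \<open>Positive \<open>i\<close> and \<open>k\<close> supply the factor 2 needed when
    \<open>2 * q ^ e\<close> or \<open>2 * q ^ f\<close> is to divide \<open>x * w + 1\<close> or
    \<open>y * z + 1\<close>.\<close>
  have "even (x * w + 1)" "even (y * z + 1)"
    using odd by auto
  then have i1: "i \<ge> 1" and k1: "k \<ge> 1"
    using n2q by (auto simp: xw yz Suc_le_eq intro!: Nat.gr0I)
  have ge: "s \<le> s * t" if "s > 0" "t > 0" for s t :: int
    using that by (simp add: mult_le_cancel_left1)

  have ej: "j < e"
  proof (rule ccontr)
    assume "\<not> j < e"
    then have "2 ^ 1 * q ^ e dvd 2 ^ i * q ^ j"
      using i1 by (intro mult_dvd_mono le_imp_power_dvd) auto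
    then have "x * y + 1 dvd x * w + 1"
      by (simp add: xy xw)
    then have "w > x * y"
      using product_plus_one_dvd_imp_gt pos ne by metis
    then show False
      using ge[of x y] pos max by linarith
  qed
  have gi: "i < g"
  proof (rule ccontr)
    assume "\<not> i < g"
    then have "x * z + 1 dvd x * w + 1"
      unfolding xz xw by (intro dvd_mult2 le_imp_power_dvd) auto
    then have "w > x * z"
      using product_plus_one_dvd_imp_gt pos ne by metis
    then show False
      using ge[of x z] pos max by linarith
  qed
  \<comment> \<open>The same size argument with \<open>y * z + 1\<close>; \<open>l < e\<close> and
    \<open>k < g\<close> later yield large divisors of \<open>x - z\<close> and
    \<open>x - y\<close>.\<close>
  have el: "l < e"
  proof (rule ccontr)
    assume "\<not> l < e"
    then have "2 ^ 1 * q ^ e dvd 2 ^ k * q ^ l"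
      using k1 by (intro mult_dvd_mono le_imp_power_dvd) auto
    then have "y * x + 1 dvd y * z + 1"
      by (simp add: xy yz mult.commute[of y x])
    then have "z > y * x"
      using product_plus_one_dvd_imp_gt[of y x z] pos max by simp
    then show False
      using ge[of x y] pos max mult.commute[of y x] by linarith
  qed
  have gk: "k < g"
  proof (rule ccontr)
    assume "\<not> k < g"
    then have "z * x + 1 dvd z * y + 1"
      unfolding mult.commute[of z] xz yz by (intro dvd_mult2 le_imp_power_dvd) auto
    then have "y > z * x"
      using product_plus_one_dvd_imp_gt[of z x y] pos max by simp
    then show False
      using ge[of x z] pos max mult.commute[of z x] by linarith
  qed

  have "q dvd x * y + 1"
    using ej by (simp add: xy)
  then have "\<not> q dvd x" "\<not> q dvd y"
    using q by (auto simp: dvd_add_right_iff)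
  then have cop: "coprime (q ^ n) x" "coprime (q ^ n) y" for n
    using q by (simp_all add: prime_imp_coprime)
  have cop2: "coprime (2 ^ n) x" for n
    using odd by simp
  \<comment> \<open>Two equations sharing \<open>x\<close> are subtracted, and \<open>x\<close> is
    cancelled by coprimality.\<close>
  have "q ^ j dvd 2 * q ^ e - 2 ^ i * q ^ j"
    using ej by (intro dvd_diff dvd_mult le_imp_power_dvd) auto
  also have "\<dots> = x * (y - w)"
    using xy xw by (simp add: algebra_simps)
  finally have "q ^ j dvd y - w"
    using cop coprime_dvd_mult_right_iff by blast
  moreover have "2 dvd y - w"
    using odd by simp
  ultimately have d1: "2 * q ^ j dvd y - w"
    using q by (intro divides_mult) auto
  have "2 ^ i dvd 2 ^ g - 2 ^ i * q ^ j"
    using gi by (intro dvd_diff dvd_mult2 le_imp_power_dvd) auto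
  also have "\<dots> = x * (z - w)"
    using xz xw by (simp add: algebra_simps)
  finally have d2: "2 ^ i dvd z - w"
    using cop2 coprime_dvd_mult_right_iff by blast
  have a1: "2 * q ^ j \<le> \<bar>y - w\<bar>"
    using d1 ne by (intro zdvd_imp_le) auto
  have a2: "2 ^ i \<le> \<bar>z - w\<bar>"
    using d2 ne by (intro zdvd_imp_le) auto
  have qpos: "q ^ n > 0" for n
    using q1 by simp
  have "(2 * q ^ j) * 2 ^ i \<le> \<bar>y - w\<bar> * \<bar>z - w\<bar>"
    using a1 a2 by (intro mult_mono) auto
  then have prod: "2 * (x * w + 1) \<le> \<bar>y - w\<bar> * \<bar>z - w\<bar>"
    unfolding xw by (simp add: mult_ac)
  have xw_pos: "x * w > 0"
    using pos by simp
  \<comment> \<open>Otherwise the two distances are at most \<open>w\<close> and \<open>x\<close>,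
    so their product is at most \<open>x * w\<close>.\<close>
  have wy: "w < y"
  proof (rule ccontr)
    assume "\<not> w < y"
    then have "\<bar>y - w\<bar> * \<bar>z - w\<bar> \<le> w * x"
      using pos max by (intro mult_mono) auto
    then show False
      using prod xw_pos by (simp add: mult.commute)
  qed
  have wz: "w < z"
  proof (rule ccontr)
    assume "\<not> w < z"
    then have "\<bar>y - w\<bar> * \<bar>z - w\<bar> \<le> x * w"
      using pos max by (intro mult_mono) auto
    then show False
      using prod xw_pos by simp
  qed
  have "(y - w) * (z - w) \<le> y * z"
    using wy wz pos by (intro mult_mono) auto
  then have "x * w + 1 < y * z + 1"
    using prod wy wz xw_pos by simp
  then have big: "2 ^ i * q ^ j < 2 ^ k * q ^ l"
    by (simp add: xw yz)

  have fl: "z * w < y" if "f \<le> l"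
  proof -
    have "2 ^ 1 * q ^ f dvd 2 ^ k * q ^ l"
      using k1 that by (intro mult_dvd_mono le_imp_power_dvd) auto
    then have "z * w + 1 dvd z * y + 1"
      by (simp add: zw yz mult.commute[of z y])
    then show ?thesis
      using product_plus_one_dvd_imp_gt pos ne by metis
  qed
  have hk: "y * w < z" if "h \<le> k"
  proof -
    have "y * w + 1 dvd y * z + 1"
      unfolding yw yz using that by (intro dvd_mult2 le_imp_power_dvd) auto
    then show ?thesis
      using product_plus_one_dvd_imp_gt pos ne by metis
  qed
  \<comment> \<open>All three pairings of the four numbers have product \<open>xyzw\<close>;
    expanding gives \<open>Q\<close> for valuations at \<open>q\<close> and \<open>T\<close> for
    valuations at 2.\<close>
  have prods: "(2 * q ^ e - 1) * (2 * q ^ f - 1) = (2 ^ i * q ^ j - 1) * (2 ^ k * q ^ l - 1)"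
    "(2 ^ g - 1) * (2 ^ h - 1) = (2 ^ i * q ^ j - 1) * (2 ^ k * q ^ l - 1)"
    by (simp_all flip: xy zw xz yw xw yz)
  then have Q: "q ^ (e + f) * 4 - q ^ e * 2 - q ^ f * 2
      = q ^ (j + l) * 2 ^ (i + k) - q ^ j * 2 ^ i - q ^ l * 2 ^ k"
    and T: "2 ^ (g + h) * 1 - 2 ^ g * 1 - 2 ^ h * 1
      = 2 ^ (i + k) * q ^ (j + l) - 2 ^ i * q ^ j - 2 ^ k * q ^ l"
    by (simp_all add: algebra_simps power_add)
  have min_f: "min j l \<le> f"
    using prime_power_min_le[OF q(1) _ ej Q] nq2[of 1] by simp
  have min_h: "min i k \<le> h"
    using prime_power_min_le[OF _ _ gi T] by simp
  have f_min: "f \<le> min j l" if "j \<noteq> l"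
    using prime_power_le_min[OF q(1) nq2 nq2 ej that Q] .
  have h_min: "h \<le> min i k" if "i \<noteq> k"
    using prime_power_le_min[OF _ n2q n2q gi that T] by simp

  have "j = l \<or> i = k"
  proof (rule ccontr)
    assume "\<not> (j = l \<or> i = k)"
    then have "z * w < y" "y * w < z"
      using f_min h_min fl hk by auto
    then show False
      using ge[of z w] ge[of y w] pos by linarith
  qed
  \<comment> \<open>The strict inequality \<open>big\<close> excludes equality of both exponents and
    fixes the direction of the remaining one.\<close>
  then consider "i = k" "j < l" | "j = l" "i < k"
  proof (elim disjE)
    assume "j = l"
    then have "i < k"
      using big qpos by simp
    then show ?thesis
      using \<open>j = l\<close> that by blast
  next
    assume "i = k"
    then have "q ^ j < q ^ l"
      using big by simp
    then have "j < l"
      using q1 by (simp add: power_strict_increasing_iff)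
    then show ?thesis
      using \<open>i = k\<close> that by blast
  qed
  then show False
  proof cases
    case 1
    \<comment> \<open>Here \<open>P = 2 ^ (i - 1)\<close>, \<open>Q = q ^ j\<close> and
      \<open>D = q ^ (l - j)\<close>; the exponent drops by one because
      \<open>no_final_configuration\<close> carries the factor 2 separately.\<close>
    then have "f = j"
      using min_f f_min by auto
    have two: "(2::int) ^ i = 2 * 2 ^ (i - 1)"
      using i1 by (cases i) auto
    have "q ^ l dvd 2 * q ^ e - 2 ^ k * q ^ l"
      using el by (intro dvd_diff dvd_mult le_imp_power_dvd) auto
    also have "\<dots> = y * (x - z)"
      using xy yz by (simp add: algebra_simps)
    finally have "q ^ l dvd x - z"
      using cop coprime_dvd_mult_right_iff by blast
    then have "q ^ j * q ^ (l - j) dvd x - z"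
      using 1 by (simp flip: power_add)
    moreover have "(2::int) ^ (i - 1) dvd y * w + 1"
      unfolding yw using min_h 1 by (intro le_imp_power_dvd) auto
    moreover have "y * z + 1 = 2 * 2 ^ (i - 1) * q ^ j * q ^ (l - j)"
      using 1 two by (simp add: yz flip: power_add mult.assoc)
    moreover have "2 * 2 ^ (i - 1) \<le> z - w"
      using a2 wz two by simp
    ultimately show False
      using no_final_configuration[of w z "2 ^ (i - 1)" "q ^ j" "q ^ (l - j)" x y]
        pos max qpos zw xw two \<open>f = j\<close> by simp
  next
    case 2
    \<comment> \<open>Now \<open>y\<close> and \<open>z\<close> are exchanged, with
      \<open>P = q ^ j\<close>, \<open>Q = 2 ^ (i - 1)\<close> and
      \<open>D = 2 ^ (k - i)\<close>.\<close>
    then have "h = i"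
      using min_h h_min by auto
    have two: "(2::int) ^ i = 2 * 2 ^ (i - 1)"
      using i1 by (cases i) auto
    have "2 ^ k dvd 2 ^ g - 2 ^ k * q ^ l"
      using gk by (intro dvd_diff dvd_mult2 le_imp_power_dvd) auto
    also have "\<dots> = z * (x - y)"
      using xz yz by (simp add: algebra_simps)
    finally have "2 ^ k dvd x - y"
      using odd coprime_dvd_mult_right_iff[of "2 ^ k" z] by simp
    moreover have "(2::int) ^ (i - 1) * 2 ^ (k - i) dvd 2 ^ k"
      unfolding power_add[symmetric] using 2 by (intro le_imp_power_dvd) simp
    ultimately have "2 ^ (i - 1) * 2 ^ (k - i) dvd x - y"
      using dvd_trans by blast
    moreover have "q ^ j dvd z * w + 1"
      unfolding zw using min_f 2 by (intro dvd_mult le_imp_power_dvd) auto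
    moreover have "(2::int) ^ k = 2 * (2 ^ (i - 1) * 2 ^ (k - i))"
      using 2 i1 by (simp flip: power_add power_Suc)
    then have "z * y + 1 = 2 * q ^ j * 2 ^ (i - 1) * 2 ^ (k - i)"
      using 2 yz by (simp add: mult.commute[of z] mult_ac)
    moreover have "2 * q ^ j \<le> y - w"
      using a1 wy by simp
    ultimately show False
      using no_final_configuration[of w y "q ^ j" "2 ^ (i - 1)" "2 ^ (k - i)" x z]
        pos max qpos yw xw two \<open>h = i\<close> by (simp add: mult_ac)
  qed
qed

text \<open>The double transpositions of the four names preserve the shape and act transitively, so
  any member can take the place of the maximal \<open>x\<close>.\<close>

lemma no_quadruple_of_shape:
  fixes q w x y z :: int
  assumes q: "prime q" "odd q"
    and pos: "x > 0" "y > 0" "z > 0" "w > 0" and odd: "odd x" "odd y" "odd z" "odd w"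
    and dist: "distinct [x, y, z, w]"
    and shape: "x * y + 1 = 2 * q ^ e" "z * w + 1 = 2 * q ^ f"
      "x * z + 1 = 2 ^ g" "y * w + 1 = 2 ^ h"
      "x * w + 1 = 2 ^ i * q ^ j" "y * z + 1 = 2 ^ k * q ^ l"
  shows False
proof -
  have shape': "y * x + 1 = 2 * q ^ e" "w * z + 1 = 2 * q ^ f"
      "z * x + 1 = 2 ^ g" "w * y + 1 = 2 ^ h"
      "w * x + 1 = 2 ^ i * q ^ j" "z * y + 1 = 2 ^ k * q ^ l"
    using shape by (simp_all add: mult.commute)
  consider "y < x" "z < x" "w < x" | "x < y" "z < y" "w < y"
    | "x < z" "y < z" "w < z" | "x < w" "y < w" "z < w"
    using dist by (auto simp: neq_iff)
  then show False
  proof cases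
    case 1
    show False
      by (rule no_quadruple_of_shape_max[OF q, of x y z w e f g h i j k l])
        (use 1 pos odd dist shape shape' in auto)
  next
    case 2
    show False
      by (rule no_quadruple_of_shape_max[OF q, of y x w z e f h g k l i j])
        (use 2 pos odd dist shape shape' in auto)
  next
    case 3
    show False
      by (rule no_quadruple_of_shape_max[OF q, of z w x y f e g h k l i j])
        (use 3 pos odd dist shape shape' in auto)
  next
    case 4
    show False
      by (rule no_quadruple_of_shape_max[OF q, of w z y x f e h g i j k l])
        (use 4 pos odd dist shape shape' in auto)
  qed
qed

section \<open>Non-squareness of -1 and its effect on triples\<close>

text \<open>If \<open>n ^ 2\<close> were -1 modulo \<open>q\<close>, raising it to the odd power
  \<open>(q - 1) / 2\<close> would give -1, whereas Fermat's theorem gives 1.\<close>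

lemma minus_one_not_square_mod_prime:
  fixes q :: nat and n :: int
  assumes "prime q" "[q = 3] (mod 4)"
  shows "\<not> int q dvd n ^ 2 + 1"
proof
  assume dvd: "int q dvd n ^ 2 + 1"
  have "q mod 4 = 3"
    using assms(2) by (simp add: cong_def)
  then obtain r where r: "q = 4 * r + 3"
    by (metis div_mult_mod_eq mult.commute)
  have "\<not> int q dvd n"
  proof
    assume "int q dvd n"
    then have "int q dvd 1"
      using dvd by (metis dvd_add_right_iff dvd_mult power2_eq_square)
    then show False
      using r by simp
  qed
  then have "\<not> q dvd nat \<bar>n\<bar>"
    by (simp add: int_dvd_int_iff[symmetric])
  then have "[nat \<bar>n\<bar> ^ (q - 1) = 1] (mod q)"
    using assms(1) fermat_theorem by blast
  then have "[int (nat \<bar>n\<bar> ^ (q - 1)) = int 1] (mod int q)"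
    by (simp only: cong_int_iff)
  moreover have "even (q - 1)"
    using r by simp
  ultimately have "[n ^ (q - 1) = 1] (mod int q)"
    by (simp add: power_even_abs)
  moreover have "q - 1 = 2 * (2 * r + 1)"
    using r by simp
  then have "n ^ (q - 1) = (n ^ 2) ^ (2 * r + 1)"
    by (simp only: power_mult)
  moreover have "[n ^ 2 = - 1] (mod int q)"
    using dvd by (simp add: cong_iff_dvd_diff)
  then have "[(n ^ 2) ^ (2 * r + 1) = (- 1) ^ (2 * r + 1)] (mod int q)"
    by (rule cong_pow)
  ultimately have "[- 1 = 1] (mod int q)"
    by (simp add: cong_def)
  then have "int q dvd 2"
    by (simp add: cong_iff_dvd_diff)
  then show False
    using zdvd_imp_le[of "int q" 2] r by simp
qed

text \<open>The three products multiply to the square of \<open>r * s * t\<close>, which would be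
  congruent to -1.\<close>

lemma not_all_products_minus_one:
  fixes m r s t :: int
  assumes "\<And>n. \<not> m dvd n ^ 2 + 1"
    and "m dvd r * s + 1" "m dvd r * t + 1" "m dvd s * t + 1"
  shows False
proof -
  have "[r * s = - 1] (mod m)" "[r * t = - 1] (mod m)" "[s * t = - 1] (mod m)"
    using assms(2-4) by (simp_all add: cong_iff_dvd_diff)
  then have "[(r * s) * (r * t) * (s * t) = (- 1) * (- 1) * (- 1)] (mod m)"
    by (intro cong_mult)
  moreover have "(r * s) * (r * t) * (s * t) = (r * s * t) ^ 2"
    by (simp add: power2_eq_square)
  ultimately have "m dvd (r * s * t) ^ 2 + 1"
    by (simp add: cong_iff_dvd_diff)
  then show False
    using assms(1) by blast
qed

lemma four_not_dvd_square_plus_one: "\<not> (4::int) dvd n ^ 2 + 1"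
proof (cases "even n")
  case True
  then have "odd (n ^ 2 + 1)"
    by simp
  then show ?thesis
    by (meson dvd_trans even_numeral)
next
  case False
  then obtain b where "n = 2 * b + 1"
    by (elim oddE)
  then have "n ^ 2 + 1 = 4 * (b ^ 2 + b) + 2"
    by (simp add: power2_eq_square algebra_simps)
  then have "(n ^ 2 + 1) mod 4 = 2"
    by (simp only: mod_mult_self4) simp
  then show ?thesis
    by (simp add: dvd_eq_mod_eq_0)
qed

lemma S_unit_two_primes_decomp:
  assumes "p \<noteq> q" "S_unit {p, q} n"
  shows "\<exists>a b. n = p ^ a * q ^ b"
proof -
  have n: "n > 0" "prime_factors n \<subseteq> {p, q}"
    using assms(2) by (auto simp: S_unit_def)
  \<comment> \<open>The exponent defaults to 0 outside \<open>prime_factors n\<close>, so the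
    factorization extends to all of \<open>{p, q}\<close> by factors 1.\<close>
  have one: "s ^ (if s \<in> prime_factors n then multiplicity s n else 0) = 1"
    if "s \<in> {p, q} - prime_factors n" for s
    using that by simp
  have "n = (\<Prod>s\<in>prime_factors n. s ^ multiplicity s n)"
    using n(1) by (rule prime_factorization_nat)
  also have "\<dots> = (\<Prod>s\<in>prime_factors n. s ^ (if s \<in> prime_factors n then multiplicity s n else 0))"
    by (rule prod.cong) auto
  also have "\<dots> = (\<Prod>s\<in>{p, q}. s ^ (if s \<in> prime_factors n then multiplicity s n else 0))"
    using n(2) one by (intro prod.mono_neutral_left) auto
  also have "\<dots> = p ^ (if p \<in> prime_factors n then multiplicity p n else 0)
      * q ^ (if q \<in> prime_factors n then multiplicity q n else 0)"
    using assms(1) by simp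
  finally show ?thesis
    by blast
qed

section \<open>Finding the prescribed pattern in an arbitrary quadruple\<close>

lemma no_two_prime_quadruple:
  fixes q a b c d :: int
  assumes q: "prime q" "odd q" and sq: "\<And>n. \<not> q dvd n ^ 2 + 1"
    and pos: "a > 0" "b > 0" "c > 0" "d > 0" and dist: "distinct [a, b, c, d]"
    and unit: "\<And>r s. r \<in> {a, b, c, d} \<Longrightarrow> s \<in> {a, b, c, d} \<Longrightarrow> r \<noteq> s \<Longrightarrow>
      \<exists>m n. r * s + 1 = 2 ^ m * q ^ n"
  shows False
proof -
  let ?X = "{a, b, c, d}"
  have posX: "r > 0" if "r \<in> ?X" for r
    using that pos by auto
  have large: "r * s \<ge> 2" if "r \<in> ?X" "s \<in> ?X" "r \<noteq> s" for r s
  proof -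
    have "r * s \<noteq> 1"
      using that posX by (auto simp: pos_zmult_eq_1_iff)
    moreover have "r * s > 0"
      using that posX by simp
    ultimately show ?thesis
      by linarith
  qed
  have not_q: "\<exists>m. r * s + 1 = 2 ^ m" and not_q_4: "4 dvd r * s + 1"
    if rs: "r \<in> ?X" "s \<in> ?X" "r \<noteq> s" and "\<not> q dvd r * s + 1" for r s
  proof -
    obtain m n where mn: "r * s + 1 = 2 ^ m * q ^ n"
      using unit rs by blast
    then have "n = 0"
      using \<open>\<not> q dvd r * s + 1\<close> by (metis dvd_mult dvd_power neq0_conv)
    then have m: "r * s + 1 = 2 ^ m"
      using mn by simp
    then show "\<exists>m. r * s + 1 = 2 ^ m"
      by blast
    \<comment> \<open>Distinct positive factors make \<open>r * s + 1\<close> at least 3, which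
      excludes the powers 1 and 2.\<close>
    have "m \<ge> 2"
    proof (rule ccontr)
      assume "\<not> m \<ge> 2"
      then have "m = 0 \<or> m = 1"
        by auto
      then show False
        using m large[OF rs] by auto
    qed
    then have "(2::int) ^ 2 dvd 2 ^ m"
      by (rule le_imp_power_dvd)
    then show "4 dvd r * s + 1"
      using m by simp
  qed
  have odd: "odd r" if r: "r \<in> ?X" for r
  proof
    assume "even r"
    \<comment> \<open>With \<open>r\<close> even, every \<open>r * s + 1\<close> is odd and so
      divisible by \<open>q\<close>. Then no product of two other members plus one is, so all three
      are divisible by 4.\<close>
    have dvd: "q dvd r * s + 1" if "s \<in> ?X" "s \<noteq> r" for s
    proof (rule ccontr)
      assume "\<not> q dvd r * s + 1"
      then have "4 dvd r * s + 1"
        using not_q_4 r that by blast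
      then have "even (r * s + 1)"
        by (meson dvd_trans even_numeral)
      then show False
        using \<open>even r\<close> by simp
    qed
    have "4 dvd s * t + 1" if "s \<in> ?X" "t \<in> ?X" "s \<noteq> r" "t \<noteq> r" "s \<noteq> t" for s t
      using not_all_products_minus_one[OF sq, of r s t] dvd that not_q_4 by blast
    moreover obtain s t u where "{s, t, u} \<subseteq> ?X" "distinct [r, s, t, u]"
    proof -
      from r consider "r = a" | "r = b" | "r = c" | "r = d"
        by blast
      then show thesis
        using that[of b c d] that[of a c d] that[of a b d] that[of a b c] dist by cases auto
    qed
    ultimately have "4 dvd s * t + 1" "4 dvd s * u + 1" "4 dvd t * u + 1"
      by auto
    then show False
      using not_all_products_minus_one[OF four_not_dvd_square_plus_one] by blast
  qed
  have not_4: "\<exists>n. r * s + 1 = 2 * q ^ n"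
    if rs: "r \<in> ?X" "s \<in> ?X" "r \<noteq> s" and "\<not> 4 dvd r * s + 1" for r s
  proof -
    obtain m n where mn: "r * s + 1 = 2 ^ m * q ^ n"
      using unit rs by blast
    have "m < 2"
    proof (rule ccontr)
      assume "\<not> m < 2"
      then have "(2::int) ^ 2 dvd 2 ^ m * q ^ n"
        by (intro dvd_mult2 le_imp_power_dvd) auto
      then show False
        using \<open>\<not> 4 dvd r * s + 1\<close> mn by simp
    qed
    moreover have "even (r * s + 1)"
      using odd rs by simp
    then have "m \<noteq> 0"
      using mn q by (auto intro!: Nat.gr0I)
    ultimately have "m = 1"
      by simp
    then show ?thesis
      using mn by auto
  qed
  have shape: False
    if X: "{x, y, z, w} = ?X" and d: "distinct [x, y, z, w]"
      and 4: "\<not> 4 dvd x * y + 1" "\<not> 4 dvd z * w + 1"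
      and nq: "\<not> q dvd x * z + 1" "\<not> q dvd y * w + 1" for x y z w
  proof -
    have in_X: "x \<in> ?X" "y \<in> ?X" "z \<in> ?X" "w \<in> ?X"
      using X by blast+
    have ne: "x \<noteq> y" "x \<noteq> z" "x \<noteq> w" "y \<noteq> z" "y \<noteq> w" "z \<noteq> w"
      using d by auto
    obtain e f g h i j k l where "x * y + 1 = 2 * q ^ e" "z * w + 1 = 2 * q ^ f"
      "x * z + 1 = 2 ^ g" "y * w + 1 = 2 ^ h"
      "x * w + 1 = 2 ^ i * q ^ j" "y * z + 1 = 2 ^ k * q ^ l"
      using not_4[of x y] not_4[of z w] not_q[of x z] not_q[of y w] unit[of x w] unit[of y z]
        in_X ne 4 nq by metis
    then show False
      using no_quadruple_of_shape[OF q] in_X posX odd d by metis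
  qed
  \<comment> \<open>\<open>T\<close> and \<open>U\<close> are disjoint edge sets of
    \<open>K\<^sub>4\<close>, each meeting every triangle.\<close>
  define T U where "T r s \<longleftrightarrow> \<not> 4 dvd r * s + 1" and "U r s \<longleftrightarrow> \<not> q dvd r * s + 1" for r s :: int
  have sym: "T r s = T s r" "U r s = U s r" for r s
    by (simp_all add: T_def U_def mult.commute)
  have TU: "\<not> (T r s \<and> U r s)" if "r \<in> ?X" "s \<in> ?X" "r \<noteq> s" for r s
    using not_q_4 that by (auto simp: T_def U_def)
  have triT: "T r s \<or> T r t \<or> T s t" and triU: "U r s \<or> U r t \<or> U s t" for r s t
    using not_all_products_minus_one[OF four_not_dvd_square_plus_one]
      not_all_products_minus_one[OF sq] by (auto simp: T_def U_def)
  have noshape: "\<not> (T x y \<and> T z w \<and> U x z \<and> U y w)"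
    if "{x, y, z, w} = ?X" "distinct [x, y, z, w]" for x y z w
    using shape that by (auto simp: T_def U_def)
  have "\<not> (T a b \<and> U a b)" "\<not> (T a c \<and> U a c)" "\<not> (T a d \<and> U a d)"
    "\<not> (T b c \<and> U b c)" "\<not> (T b d \<and> U b d)" "\<not> (T c d \<and> U c d)"
    using TU dist by auto
  \<comment> \<open>These are the six ordered pairs of distinct perfect matchings. A set without a
    perfect matching lies in a star, which misses a triangle, or in a triangle; in the latter case
    it is the whole triangle, which the other set then misses.\<close>
  moreover have "\<not> (T a b \<and> T c d \<and> U a c \<and> U b d)" "\<not> (T a b \<and> T d c \<and> U a d \<and> U b c)"
    "\<not> (T a c \<and> T b d \<and> U a b \<and> U c d)" "\<not> (T a c \<and> T d b \<and> U a d \<and> U c b)"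
    "\<not> (T a d \<and> T b c \<and> U a b \<and> U d c)" "\<not> (T a d \<and> T c b \<and> U a c \<and> U d b)"
    using dist by (intro noshape; auto)+
  ultimately show False
    using triT[of a b c] triT[of a b d] triT[of a c d] triT[of b c d]
      triU[of a b c] triU[of a b d] triU[of a c d] triU[of b c d]
      sym[of d c] sym[of d b] sym[of c b]
    by argo
qed

section \<open>Transfer from lists of naturals to integers\<close>

theorem theorem1:
  fixes q :: nat
  assumes "prime q" and "[q = 3] (mod 4)"
  shows "\<not> (\<exists>xs. S_diophantine_quadruple {2, q} xs)"
proof
  assume "\<exists>xs. S_diophantine_quadruple {2, q} xs"
  then obtain xs where xs: "length xs = 4" "\<forall>x\<in>set xs. x > 0" "distinct xs"
    and unit: "\<And>i j. i < 4 \<Longrightarrow> j < 4 \<Longrightarrow> i \<noteq> j \<Longrightarrow> S_unit {2, q} (xs ! i * xs ! j + 1)"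
    by (auto simp: S_diophantine_tuple_def)
  have "q mod 4 = 3"
    using assms(2) by (simp add: cong_def)
  then have "odd q"
    by presburger
  have unit': "\<exists>m n. int r * int s + 1 = 2 ^ m * int q ^ n"
    if rs: "r \<in> set xs" "s \<in> set xs" "r \<noteq> s" for r s
  proof -
    have "S_unit {2, q} (r * s + 1)"
      using rs unit xs(1) by (metis in_set_conv_nth)
    then obtain m n where "r * s + 1 = 2 ^ m * q ^ n"
      using S_unit_two_primes_decomp[of 2 q] \<open>odd q\<close> by (metis even_numeral)
    then have "int (r * s + 1) = int (2 ^ m * q ^ n)"
      by simp
    then have "int r * int s + 1 = 2 ^ m * int q ^ n"
      by simp
    then show ?thesis
      by blast
  qed
  obtain a b c d where abcd: "xs = [a, b, c, d]"
    using xs(1) by (auto simp: numeral_eq_Suc length_Suc_conv)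
  show False
  proof (rule no_two_prime_quadruple[of "int q" "int a" "int b" "int c" "int d"])
    show "\<exists>m n. r * s + 1 = 2 ^ m * int q ^ n"
      if "r \<in> {int a, int b, int c, int d}" "s \<in> {int a, int b, int c, int d}" "r \<noteq> s" for r s
      using that unit' abcd by auto
  qed (use assms \<open>odd q\<close> xs abcd minus_one_not_square_mod_prime in auto)
qed

end
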